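(* Let $\mathcal{X}$ be a finite set, let $\pi$ be a probability measure on $\mathcal{X}$ with strictly positive masses, let $P\in\mathcal{L}(\pi)$, and let $S\subseteq\mathcal{X}$ range over sets with $S\ne\emptyset,\mathcal{X}$, with complement $S'$. 1. Assume further that $P$ is positive-semidefinite. Then $$\|G_SPG_S-\Pi\|_{F,\pi}=\left(3-\frac{1}{\pi(S)\pi(S')}\right)+\frac{1}{\pi(S)}\sum_{x\in S'}\sum_{y\in S'}\pi(x)P(x,y)+\frac{1}{\pi(S')}\sum_{x\in S}\sum_{y\in S}\pi(x)P(x,y),$$ where, as functions of $S$, the first term (in parentheses) is submodular and the second and third terms are supermodular; so this is a decomposition as a difference of two submodular functions. 2. (Without assuming positive-semidefiniteness.) $$\|G_SP-\Pi\|_{F,\pi}^2=\left(3-\frac{1}{\pi(S)\pi(S')}\right)+\frac{1}{\pi(S)}\sum_{x\in S'}\sum_{y\in S'}\pi(x)P^2(x,y)+\frac{1}{\pi(S')}\sum_{x\in S}\sum_{y\in S}\pi(x)P^2(x,y),$$ where, as functions of $S$, the first term (in parentheses) is submodular and the second and third terms are supermodular; so this is a decomposition as a difference of two submodular functions.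
   Context: $\mathcal{L}(\pi)$ is the set of $\pi$-reversible transition matrices on $\mathcal{X}$. $\pi(A)=\sum_{z\in A}\pi(z)$. $G_S$ is the Gibbs kernel of the partition $\mathcal{X}=S\sqcup S'$: $G_S(x,y)=\pi(y)/\pi(S)$ if $x,y\in S$, $\pi(y)/\pi(S')$ if $x,y\in S'$, and $0$ otherwise. $\Pi$ is the matrix all of whose rows equal $\pi$. $\|M\|_{F,\pi}^2=\mathrm{Tr}(M^*M)$ with $M^*(x,y)=\frac{\pi(y)}{\pi(x)}M(y,x)$. $P^2$ is the matrix square of $P$. $P$ is positive-semidefinite if $\sum_xf(x)(Pf)(x)\pi(x)\ge0$ for all $f:\mathcal{X}\to\mathbb{R}$. A real function $F$ on the family $\{S\subseteq\mathcal{X}:0<\pi(S)<1\}$ is submodular if $F(A\cap B)+F(A\cup B)\le F(A)+F(B)$ for all $A,B$ such that $A,B,A\cap B,A\cup B$ all lie in this family, and supermodular if $-F$ is submodular. *)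

theory Defs
  imports "HOL-Analysis.Analysis" "HOL-Probability.Probability_Mass_Function"
begin

text \<open>The finite state space is a type \<open>'a::finite\<close>. A matrix on it is an element
  of \<open>real^'a^'a\<close>, where \<open>M $ x $ y\<close> is the entry in row \<open>x\<close> and column \<open>y\<close>.\<close>

definition reversible_kernels :: "'a::finite pmf \<Rightarrow> (real^'a^'a) set" where
  "reversible_kernels p = {P.
     (\<forall>x y. 0 \<le> P $ x $ y) \<and>
     (\<forall>x. (\<Sum>y\<in>UNIV. P $ x $ y) = 1) \<and>
     (\<forall>x y. pmf p x * P $ x $ y = pmf p y * P $ y $ x)}"

definition positive_semidefinite :: "'a::finite pmf \<Rightarrow> real^'a^'a \<Rightarrow> bool" where
  "positive_semidefinite p P \<longleftrightarrow>
     (\<forall>f :: real^'a. 0 \<le> (\<Sum>x\<in>UNIV. f $ x * (P *v f) $ x * pmf p x))"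

definition gibbs_kernel :: "'a::finite pmf \<Rightarrow> 'a set \<Rightarrow> real^'a^'a" where
  "gibbs_kernel p S = (\<chi> x y.
     if x \<in> S \<and> y \<in> S then pmf p y / measure_pmf.prob p S
     else if x \<in> - S \<and> y \<in> - S then pmf p y / measure_pmf.prob p (- S)
     else 0)"

definition stationary_matrix :: "'a::finite pmf \<Rightarrow> real^'a^'a" where
  "stationary_matrix p = (\<chi> x y. pmf p y)"

definition pi_adjoint :: "'a::finite pmf \<Rightarrow> real^'a^'a \<Rightarrow> real^'a^'a" where
  "pi_adjoint p M = (\<chi> x y. pmf p y / pmf p x * M $ y $ x)"

definition frobenius_norm :: "'a::finite pmf \<Rightarrow> real^'a^'a \<Rightarrow> real" where
  "frobenius_norm p M = sqrt (trace (pi_adjoint p M ** M))"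

text \<open>Submodularity on the family of sets of mass strictly between 0 and 1. This family
  is not a lattice, so the intersection and union are required to belong to it.\<close>

definition nontrivial_sets :: "'a pmf \<Rightarrow> 'a set set" where
  "nontrivial_sets p = {S. 0 < measure_pmf.prob p S \<and> measure_pmf.prob p S < 1}"

definition submodular :: "'a pmf \<Rightarrow> ('a set \<Rightarrow> real) \<Rightarrow> bool" where
  "submodular p F \<longleftrightarrow> (\<forall>A B.
     A \<in> nontrivial_sets p \<longrightarrow> B \<in> nontrivial_sets p \<longrightarrow>
     A \<inter> B \<in> nontrivial_sets p \<longrightarrow> A \<union> B \<in> nontrivial_sets p \<longrightarrow>
     F (A \<inter> B) + F (A \<union> B) \<le> F A + F B)"

definition supermodular :: "'a pmf \<Rightarrow> ('a set \<Rightarrow> real) \<Rightarrow> bool" where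
  "supermodular p F \<longleftrightarrow> submodular p (\<lambda>S. - F S)"

end

theory Submission imports Defs begin

text \<open>Write \<open>q(A,B)\<close> for the probability that the stationary chain jumps from \<open>A\<close> to \<open>B\<close>,
  \<open>s = \<pi>(S)\<close>, \<open>t = \<pi>(S')\<close> and \<open>c = q(S,S') = q(S',S)\<close>. The entry of \<open>G\<^sub>S P G\<^sub>S - \<Pi>\<close> at \<open>(x,y)\<close> is
  \<open>\<pi>(y)\<close> times a quantity depending only on the blocks of \<open>x\<close> and \<open>y\<close>; summing squares gives
  the norm \<open>\<bar>1 - c/(st)\<bar>\<close>, and the absolute value is removed by testing positivity of \<open>P\<close> on
  \<open>1\<^sub>S / s - 1\<^sub>S' / t\<close>. For \<open>G\<^sub>S P - \<Pi>\<close> the squared norm is the trace of \<open>G\<^sub>S P\<^sup>2\<close> minus one.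

  Submodularity of the first term is convexity of \<open>1/s + 1/(1-s)\<close>. The third term is a product of
  the nonnegative, increasing, supermodular functions \<open>1/\<pi>(S')\<close> and \<open>q(S,S)\<close>, hence
  supermodular, and the second term is the third one evaluated at the complement.\<close>

subsection \<open>Supermodular functions\<close>

text \<open>For a fixed sum, spreading the pair lowers the product: a*b - i*u = (a - i)*(b - i).
  Both sums of reciprocals have the same numerator a + b.\<close>

lemma inverse_add_le:
  fixes a b i u :: real
  assumes "0 < i" "i \<le> a" "i \<le> b" "i + u = a + b"
  shows "1 / a + 1 / b \<le> 1 / i + 1 / u"
proof -
  have u: "u = a + b - i" and p: "0 < a" "0 < b" "0 < u"
    using assms by auto
  have "a * b - i * u = (a - i) * (b - i)"
    unfolding u by (simp add: algebra_simps)
  also have "\<dots> \<ge> 0" using assms by simp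
  finally have "i * u \<le> a * b" by simp
  then have "(a + b) / (a * b) \<le> (a + b) / (i * u)"
    using p assms by (intro divide_left_mono) auto
  moreover have "1 / a + 1 / b = (a + b) / (a * b)" "1 / i + 1 / u = (a + b) / (i * u)"
    using p assms by (auto simp: field_simps)
  ultimately show ?thesis by simp
qed

text \<open>The indices i and u stand for intersection and union. If f and g were modular, the gap
  would be the sum of two cross products of nonnegative increments; raising the union values to
  \<open>fu\<close> and \<open>gu\<close> only enlarges it, by nonnegativity.\<close>

lemma mult_supermodular_le:
  fixes fa fb fi fu ga gb gi gu :: real
  assumes "0 \<le> fi" "fi \<le> fa" "fi \<le> fb" "fa + fb \<le> fi + fu"
    and "0 \<le> gi" "gi \<le> ga" "gi \<le> gb" "ga + gb \<le> gi + gu"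
  shows "fa * ga + fb * gb \<le> fi * gi + fu * gu"
proof -
  have "0 \<le> (fa - fi) * (gb - gi) + (fb - fi) * (ga - gi)"
    using assms by (intro add_nonneg_nonneg mult_nonneg_nonneg) auto
  also have "\<dots> = fi * gi + (fa + fb - fi) * (ga + gb - gi) - (fa * ga + fb * gb)"
    by (simp add: algebra_simps)
  finally have "fa * ga + fb * gb \<le> fi * gi + (fa + fb - fi) * (ga + gb - gi)" by simp
  also have "(fa + fb - fi) * (ga + gb - gi) \<le> fu * gu"
    using assms by (intro mult_mono) auto
  finally show ?thesis by simp
qed

lemma prob_Compl_pmf: "measure_pmf.prob p (- S) = 1 - measure_pmf.prob p S"
  using measure_pmf.prob_compl[of S p] by (simp add: Compl_eq_Diff_UNIV)

lemma prob_Int_add_Un_pmf: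
  fixes p :: "'a::finite pmf"
  shows "measure_pmf.prob p (A \<inter> B) + measure_pmf.prob p (A \<union> B)
    = measure_pmf.prob p A + measure_pmf.prob p B"
  using sum.union_inter[of A B "pmf p"] by (simp add: measure_measure_pmf_finite)

lemma Compl_in_nontrivial_sets_iff [simp]: "- S \<in> nontrivial_sets p \<longleftrightarrow> S \<in> nontrivial_sets p"
  by (auto simp: nontrivial_sets_def prob_Compl_pmf)

lemma supermodular_iff:
  "supermodular p F \<longleftrightarrow> (\<forall>A\<in>nontrivial_sets p. \<forall>B\<in>nontrivial_sets p.
     A \<inter> B \<in> nontrivial_sets p \<longrightarrow> A \<union> B \<in> nontrivial_sets p \<longrightarrow>
     F A + F B \<le> F (A \<inter> B) + F (A \<union> B))"
  unfolding supermodular_def submodular_def by (auto simp: algebra_simps)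

text \<open>Complementation preserves the family and, by De Morgan, swaps intersection and union,
  which enter the inequality symmetrically.\<close>

lemma supermodular_Compl:
  assumes "supermodular p F"
  shows "supermodular p (\<lambda>S. F (- S))"
  unfolding supermodular_iff
proof (intro ballI impI)
  fix A B assume "A \<in> nontrivial_sets p" "B \<in> nontrivial_sets p"
    "A \<inter> B \<in> nontrivial_sets p" "A \<union> B \<in> nontrivial_sets p"
  then have "- A \<in> nontrivial_sets p" "- B \<in> nontrivial_sets p"
    "- A \<inter> - B \<in> nontrivial_sets p" "- A \<union> - B \<in> nontrivial_sets p"
    by (simp_all only: Compl_in_nontrivial_sets_iff flip: Compl_Int Compl_Un)
  then have "F (- A) + F (- B) \<le> F (- A \<inter> - B) + F (- A \<union> - B)"
    using assms unfolding supermodular_iff by blast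
  then show "F (- A) + F (- B) \<le> F (- (A \<inter> B)) + F (- (A \<union> B))"
    by (simp add: add.commute)
qed

lemma submodular_uminus_add:
  assumes "supermodular p F" "supermodular p G"
  shows "submodular p (\<lambda>S. - (F S + G S))"
  using assms unfolding supermodular_def submodular_def by (smt (verit))

lemma supermodular_mult:
  assumes "supermodular p F" "supermodular p G"
    and "\<And>A. A \<in> nontrivial_sets p \<Longrightarrow> 0 \<le> F A" "\<And>A. A \<in> nontrivial_sets p \<Longrightarrow> 0 \<le> G A"
    and "\<And>A B. A \<in> nontrivial_sets p \<Longrightarrow> B \<in> nontrivial_sets p \<Longrightarrow> A \<subseteq> B \<Longrightarrow> F A \<le> F B"
    and "\<And>A B. A \<in> nontrivial_sets p \<Longrightarrow> B \<in> nontrivial_sets p \<Longrightarrow> A \<subseteq> B \<Longrightarrow> G A \<le> G B"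
  shows "supermodular p (\<lambda>S. F S * G S)"
  unfolding supermodular_iff
  using assms(1,2) unfolding supermodular_iff
  by (intro ballI impI mult_supermodular_le) (auto intro: assms)

text \<open>The mass is modular, so \<open>inverse_add_le\<close> applies with the masses of the
  intersection and union as the spread pair.\<close>

lemma supermodular_inverse_prob:
  fixes p :: "'a::finite pmf"
  shows "supermodular p (\<lambda>S. 1 / measure_pmf.prob p S)"
  unfolding supermodular_iff
  by (intro ballI impI inverse_add_le prob_Int_add_Un_pmf measure_pmf.finite_measure_mono)
    (auto simp: nontrivial_sets_def)

lemma submodular_first_term:
  fixes p :: "'a::finite pmf"
  shows "submodular p (\<lambda>S. 3 - 1 / (measure_pmf.prob p S * measure_pmf.prob p (- S)))"
proof -
  let ?f = "\<lambda>S. 1 / measure_pmf.prob p S" and ?g = "\<lambda>S. 1 / measure_pmf.prob p (- S)"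
  have "submodular p (\<lambda>S. - (?f S + ?g S))"
    by (intro submodular_uminus_add supermodular_Compl[where F = ?f] supermodular_inverse_prob)
  \<comment> \<open>Partial fractions with masses summing to 1. The identity breaks at mass 0 or 1,
    where division by zero gives 0, but submodularity only looks inside the family.\<close>
  moreover have "1 / (measure_pmf.prob p S * measure_pmf.prob p (- S)) = ?f S + ?g S"
    if "S \<in> nontrivial_sets p" for S
    using that by (auto simp: nontrivial_sets_def prob_Compl_pmf divide_simps)
  ultimately show ?thesis
    unfolding submodular_def by (smt (verit))
qed

subsection \<open>Stationary flow between sets\<close>

text \<open>The double sum has the exact shape used in the final statement, so unfolding it there
  matches the goal.\<close>

definition flow :: "'a::finite pmf \<Rightarrow> real^'a^'a \<Rightarrow> 'a set \<Rightarrow> 'a set \<Rightarrow> real" where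
  "flow p P A B = (\<Sum>x\<in>A. \<Sum>y\<in>B. pmf p x * P $ x $ y)"

lemma sum_UNIV_split:
  fixes S :: "'a::finite set"
  shows "sum f UNIV = sum f S + sum f (- S)"
  using sum.union_disjoint[of S "- S" f] by (simp add: Compl_partition)

lemma flow_mono:
  assumes "P \<in> reversible_kernels p" "A \<subseteq> B"
  shows "flow p P A A \<le> flow p P B B"
  using assms unfolding flow_def sum.cartesian_product reversible_kernels_def
  by (intro sum_mono2) auto

lemma flow_nonneg:
  assumes "P \<in> reversible_kernels p"
  shows "0 \<le> flow p P A B"
  using assms unfolding flow_def reversible_kernels_def by (intro sum_nonneg) auto

lemma flow_commute:
  assumes "P \<in> reversible_kernels p"
  shows "flow p P A B = flow p P B A"
proof -
  have "flow p P A B = (\<Sum>x\<in>A. \<Sum>y\<in>B. pmf p y * P $ y $ x)"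
    using assms unfolding flow_def reversible_kernels_def by (intro sum.cong) auto
  then show ?thesis unfolding flow_def by (subst sum.swap) simp
qed

text \<open>Rows sum to 1, so the mass of A is all outgoing flow. With \<open>flow_commute\<close>,
  every flow between S and its complement is then expressed through the single crossing flow
  c.\<close>

lemma flow_self:
  assumes "P \<in> reversible_kernels p"
  shows "flow p P A A = measure_pmf.prob p A - flow p P A (- A)"
proof -
  have "flow p P A A + flow p P A (- A) = (\<Sum>x\<in>A. \<Sum>y\<in>UNIV. pmf p x * P $ x $ y)"
    unfolding flow_def sum_UNIV_split[of _ A] by (simp add: sum.distrib)
  also have "\<dots> = measure_pmf.prob p A"
    using assms
    by (simp add: reversible_kernels_def measure_measure_pmf_finite flip: sum_distrib_left)
  finally show ?thesis by simp
qed

text \<open>Flow is a nonnegative measure on pairs. The squares of A and B meet in the square of the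
  intersection, and their union lies in the square of the union; the missing pairs join A - B to B -
  A.\<close>

lemma supermodular_flow:
  assumes "P \<in> reversible_kernels p"
  shows "supermodular p (\<lambda>S. flow p P S S)"
  unfolding supermodular_iff
proof (intro ballI impI)
  fix A B
  let ?q = "\<lambda>(x, y). pmf p x * P $ x $ y"
  have "flow p P A A + flow p P B B = sum ?q (A \<times> A \<union> B \<times> B) + sum ?q (A \<times> A \<inter> B \<times> B)"
    unfolding flow_def sum.cartesian_product by (subst sum.union_inter) auto
  also have "A \<times> A \<inter> B \<times> B = (A \<inter> B) \<times> (A \<inter> B)" by auto
  also have "sum ?q (A \<times> A \<union> B \<times> B) \<le> sum ?q ((A \<union> B) \<times> (A \<union> B))"
    using assms by (intro sum_mono2) (auto simp: reversible_kernels_def)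
  finally show "flow p P A A + flow p P B B \<le> flow p P (A \<inter> B) (A \<inter> B) + flow p P (A \<union> B) (A \<union> B)"
    unfolding flow_def sum.cartesian_product by simp
qed

lemma supermodular_third_term:
  assumes "P \<in> reversible_kernels p"
  shows "supermodular p (\<lambda>S. 1 / measure_pmf.prob p (- S) * flow p P S S)"
proof (rule supermodular_mult)
  show "supermodular p (\<lambda>S. 1 / measure_pmf.prob p (- S))"
    by (rule supermodular_Compl[OF supermodular_inverse_prob])
  show "supermodular p (\<lambda>S. flow p P S S)"
    by (rule supermodular_flow[OF assms])
  show "1 / measure_pmf.prob p (- A) \<le> 1 / measure_pmf.prob p (- B)"
    if "A \<in> nontrivial_sets p" "B \<in> nontrivial_sets p" "A \<subseteq> B" for A B
    using that measure_pmf.finite_measure_mono[of "- B" "- A" p]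
    by (auto simp: nontrivial_sets_def prob_Compl_pmf intro!: divide_left_mono)
qed (use assms in \<open>auto intro: flow_nonneg flow_mono\<close>)

lemma supermodular_second_term:
  assumes "P \<in> reversible_kernels p"
  shows "supermodular p (\<lambda>S. 1 / measure_pmf.prob p S * flow p P (- S) (- S))"
  using supermodular_Compl[OF supermodular_third_term[OF assms]] by simp

lemma prob_pos:
  fixes p :: "'a::finite pmf"
  assumes "\<forall>x. 0 < pmf p x" "S \<noteq> {}"
  shows "0 < measure_pmf.prob p S"
  using assms by (auto simp: measure_measure_pmf_finite intro!: sum_pos)

text \<open>The first expression is the target right-hand side, the second is what the norm of
  \<open>gibbs_kernel p S ** P - stationary_matrix p\<close> produces, with the squared kernel in
  the role of P. Both collapse to the same function of c.\<close>

lemma flow_decomposition: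
  assumes "\<forall>x. 0 < pmf p x" "P \<in> reversible_kernels p" "S \<noteq> {}" "S \<noteq> UNIV"
  defines "s \<equiv> measure_pmf.prob p S" and "t \<equiv> measure_pmf.prob p (- S)"
    and "c \<equiv> flow p P S (- S)"
  shows "(3 - 1 / (s * t)) + 1 / s * flow p P (- S) (- S) + 1 / t * flow p P S S = 1 - c / (s * t)"
    and "flow p P S S / s + flow p P (- S) (- S) / t - 1 = 1 - c / (s * t)"
proof -
  have st: "s > 0" "t > 0" "t = 1 - s"
    using prob_pos[OF assms(1,3)] prob_pos[OF assms(1), of "- S"] assms(4) prob_Compl_pmf[of p S]
    by (auto simp: s_def t_def)
  have "flow p P S S = s - c" "flow p P (- S) (- S) = t - c"
    using assms flow_self[of P p S] flow_self[of P p "- S"] flow_commute[of P p S "- S"] by auto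
  \<comment> \<open>From s + t = 1 come t/s + s/t = 1/(s*t) - 2 and 1/s + 1/t = 1/(s*t): hence the
    constant 3 = 1 + 2 and the subtracted 1/(s*t).\<close>
  moreover have "(3 - 1 / (s * t)) + 1 / s * (t - c) + 1 / t * (s - c) = 1 - c / (s * t)"
    "(s - c) / s + (t - c) / t - 1 = 1 - c / (s * t)"
    using st(1,2) by (simp_all add: divide_simps) (simp_all add: st(3) algebra_simps)
  ultimately show "(3 - 1 / (s * t)) + 1 / s * flow p P (- S) (- S) + 1 / t * flow p P S S = 1 - c / (s * t)"
    "flow p P S S / s + flow p P (- S) (- S) / t - 1 = 1 - c / (s * t)"
    by simp_all
qed

lemma reversible_kernels_square:
  assumes "P \<in> reversible_kernels p"
  shows "P ** P \<in> reversible_kernels p"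
proof -
  have nn: "0 \<le> P $ x $ y" and row: "(\<Sum>y\<in>UNIV. P $ x $ y) = 1"
    and rev: "pmf p x * P $ x $ y = pmf p y * P $ y $ x" for x y
    using assms by (auto simp: reversible_kernels_def)
  have "(\<Sum>y\<in>UNIV. (P ** P) $ x $ y) = 1" for x
  proof -
    have "(\<Sum>y\<in>UNIV. (P ** P) $ x $ y) = (\<Sum>z\<in>UNIV. P $ x $ z * (\<Sum>y\<in>UNIV. P $ z $ y))"
      unfolding matrix_matrix_mult_def by (simp add: sum_distrib_left) (rule sum.swap)
    then show ?thesis by (simp add: row)
  qed
  moreover have "pmf p x * (P ** P) $ x $ y = pmf p y * (P ** P) $ y $ x" for x y
  proof -
    \<comment> \<open>Detailed balance is applied on each edge of the path x, z, y, reversing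
      it.\<close>
    have "pmf p x * (P $ x $ z * P $ z $ y) = pmf p y * (P $ y $ z * P $ z $ x)" for z
      using rev[of x z] rev[of z y] by (metis mult.assoc mult.commute)
    then show ?thesis by (simp add: matrix_matrix_mult_def sum_distrib_left)
  qed
  ultimately show ?thesis
    by (auto simp: reversible_kernels_def matrix_matrix_mult_def nn intro!: sum_nonneg)
qed

subsection \<open>Frobenius norms\<close>

lemma frobenius_norm_square:
  fixes p :: "'a::finite pmf"
  assumes "\<forall>x. 0 < pmf p x"
  shows "(frobenius_norm p M)\<^sup>2 = (\<Sum>x\<in>UNIV. \<Sum>y\<in>UNIV. pmf p x / pmf p y * (M $ x $ y)\<^sup>2)"
proof -
  have "trace (pi_adjoint p M ** M) = (\<Sum>x\<in>UNIV. \<Sum>y\<in>UNIV. pmf p x / pmf p y * (M $ x $ y)\<^sup>2)"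
    unfolding trace_def pi_adjoint_def matrix_matrix_mult_def
    by (subst sum.swap) (simp add: power2_eq_square mult.assoc)
  \<comment> \<open>Needed for the square to cancel the square root defining the norm.\<close>
  moreover have "\<dots> \<ge> 0" by (intro sum_nonneg) simp
  ultimately show ?thesis by (simp add: frobenius_norm_def)
qed

definition block :: "'a set \<Rightarrow> 'a \<Rightarrow> 'a set" where
  "block S x = (if x \<in> S then S else - S)"

text \<open>Lying in the same block is symmetric. The first form restricts a sum over the column
  index, for the kernel as left factor; the second restricts the row index, for the kernel as right
  factor.\<close>

lemma gibbs_kernel_nth:
  "gibbs_kernel p S $ x $ y = (if y \<in> block S x then pmf p y / measure_pmf.prob p (block S x) else 0)"
  "gibbs_kernel p S $ x $ y = (if x \<in> block S y then pmf p y / measure_pmf.prob p (block S y) else 0)"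
  by (auto simp: gibbs_kernel_def block_def)

lemma gibbs_kernel_mult_nth:
  "(gibbs_kernel p S ** P) $ x $ y
     = flow p P (block S x) {y} / measure_pmf.prob p (block S x)"
  unfolding matrix_matrix_mult_def flow_def
  by (simp add: gibbs_kernel_nth(1) if_distrib[of "\<lambda>a. a * _"] sum_divide_distrib sum.If_cases cong: if_cong)

lemma gibbs_kernel_sandwich_nth:
  "(gibbs_kernel p S ** P ** gibbs_kernel p S) $ x $ y = pmf p y * flow p P (block S x) (block S y)
     / (measure_pmf.prob p (block S x) * measure_pmf.prob p (block S y))"
proof -
  have "(gibbs_kernel p S ** P ** gibbs_kernel p S) $ x $ y
    = (\<Sum>z\<in>block S y. flow p P (block S x) {z} / measure_pmf.prob p (block S x)
        * (pmf p y / measure_pmf.prob p (block S y)))"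
    unfolding matrix_matrix_mult_def[of _ "gibbs_kernel p S"]
    by (simp add: gibbs_kernel_mult_nth gibbs_kernel_nth(2) if_distrib[of "(*) _"] sum.If_cases cong: if_cong)
  also have "\<dots> = (\<Sum>z\<in>block S y. flow p P (block S x) {z}) * pmf p y
     / (measure_pmf.prob p (block S x) * measure_pmf.prob p (block S y))"
    by (simp add: sum_distrib_right sum_divide_distrib)
  also have "(\<Sum>z\<in>block S y. flow p P (block S x) {z}) = flow p P (block S x) (block S y)"
    unfolding flow_def by (simp add: sum.swap[of _ "block S y"])
  finally show ?thesis by (simp add: mult.commute)
qed

text \<open>A summand that sees its state only through the block reduces to two terms, which turns
  the norms into finite algebra in s, t and c.\<close>

lemma sum_block:
  fixes p :: "'a::finite pmf"
  shows "(\<Sum>x\<in>UNIV. pmf p x * h (block S x))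
    = measure_pmf.prob p S * h S + measure_pmf.prob p (- S) * h (- S)"
  unfolding sum_UNIV_split[of _ S]
  by (simp add: block_def measure_measure_pmf_finite sum_distrib_right)

lemma frobenius_norm_sandwich_square:
  assumes "\<forall>x. 0 < pmf p x" "P \<in> reversible_kernels p" "S \<noteq> {}" "S \<noteq> UNIV"
  shows "(frobenius_norm p (gibbs_kernel p S ** P ** gibbs_kernel p S - stationary_matrix p))\<^sup>2
    = (1 - flow p P S (- S) / (measure_pmf.prob p S * measure_pmf.prob p (- S)))\<^sup>2"
proof -
  define s t c where "s = measure_pmf.prob p S" and "t = measure_pmf.prob p (- S)"
    and "c = flow p P S (- S)"
  have st: "s > 0" "t > 0" "t = 1 - s"
    using prob_pos[OF assms(1,3)] prob_pos[OF assms(1), of "- S"] assms(4) prob_Compl_pmf[of p S]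
    by (auto simp: s_def t_def)
  have fl: "flow p P S S = s - c" "flow p P (- S) (- S) = t - c" "flow p P (- S) S = c"
    using assms flow_self[of P p S] flow_self[of P p "- S"] flow_commute[of P p S "- S"]
    by (auto simp: s_def t_def c_def)
  define k where "k A B = (flow p P A B / (measure_pmf.prob p A * measure_pmf.prob p B) - 1)\<^sup>2" for A B
  have "pmf p x / pmf p y * ((gibbs_kernel p S ** P ** gibbs_kernel p S - stationary_matrix p) $ x $ y)\<^sup>2
    = pmf p x * (pmf p y * k (block S x) (block S y))" for x y
  proof -
    have eq: "(gibbs_kernel p S ** P ** gibbs_kernel p S - stationary_matrix p) $ x $ y
      = pmf p y * (flow p P (block S x) (block S y)
          / (measure_pmf.prob p (block S x) * measure_pmf.prob p (block S y)) - 1)"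
      by (simp add: gibbs_kernel_sandwich_nth stationary_matrix_def algebra_simps)
    show ?thesis
      unfolding eq k_def power_mult_distrib using assms(1)[rule_format, of y]
      by (simp add: power2_eq_square)
  qed
  then have "(frobenius_norm p (gibbs_kernel p S ** P ** gibbs_kernel p S - stationary_matrix p))\<^sup>2
    = (\<Sum>x\<in>UNIV. pmf p x * (\<Sum>y\<in>UNIV. pmf p y * k (block S x) (block S y)))"
    by (simp add: frobenius_norm_square[OF assms(1)] sum_distrib_left)
  also have "\<dots> = s * (s * k S S + t * k S (- S)) + t * (s * k (- S) S + t * k (- S) (- S))"
    unfolding sum_block[where h = "k _"] sum_block[where h = "\<lambda>A. _ * k A S + _ * k A (- S)"]
    by (simp add: s_def t_def)
  also have "\<dots> = s * s * ((s - c) / (s * s) - 1)\<^sup>2 + 2 * s * t * (c / (s * t) - 1)\<^sup>2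
      + t * t * ((t - c) / (t * t) - 1)\<^sup>2"
    unfolding k_def fl s_def[symmetric] t_def[symmetric] c_def[symmetric] by (simp add: algebra_simps)
  \<comment> \<open>All block deviations share the numerator s*t - c up to sign, since s - s*s = s*t
    = t - t*t. The weighted squares then complete the square of 1/s + 1/t.\<close>
  also have "(s - c) / (s * s) - 1 = (s * t - c) / (s * s)"
    using st by (simp add: divide_simps) (simp add: algebra_simps)
  also have "c / (s * t) - 1 = - ((s * t - c) / (s * t))"
    using st by (simp add: divide_simps)
  also have "(t - c) / (t * t) - 1 = (s * t - c) / (t * t)"
    using st(1,2) by (simp add: divide_simps) (simp add: st(3) algebra_simps)
  also have "s * s * ((s * t - c) / (s * s))\<^sup>2 + 2 * s * t * (- ((s * t - c) / (s * t)))\<^sup>2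
      + t * t * ((s * t - c) / (t * t))\<^sup>2 = (s * t - c)\<^sup>2 * (1 / s + 1 / t)\<^sup>2"
    using st(1,2) by (simp add: power2_eq_square divide_simps) (simp add: algebra_simps)
  also have "1 / s + 1 / t = 1 / (s * t)"
    using st by (simp add: divide_simps)
  also have "(s * t - c)\<^sup>2 * (1 / (s * t))\<^sup>2 = (1 - c / (s * t))\<^sup>2"
    using st(1,2) unfolding power_mult_distrib[symmetric] by (simp add: divide_simps)
  finally show ?thesis by (simp add: s_def t_def c_def)
qed

lemma positive_semidefinite_flow_le:
  assumes "\<forall>x. 0 < pmf p x" "P \<in> reversible_kernels p" "S \<noteq> {}" "S \<noteq> UNIV"
    and "positive_semidefinite p P"
  shows "flow p P S (- S) / (measure_pmf.prob p S * measure_pmf.prob p (- S)) \<le> 1"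
proof -
  define s t c where "s = measure_pmf.prob p S" and "t = measure_pmf.prob p (- S)"
    and "c = flow p P S (- S)"
  have st: "s > 0" "t > 0" "t = 1 - s"
    using prob_pos[OF assms(1,3)] prob_pos[OF assms(1), of "- S"] assms(4) prob_Compl_pmf[of p S]
    by (auto simp: s_def t_def)
  have fl: "flow p P S S = s - c" "flow p P (- S) (- S) = t - c" "flow p P (- S) S = c"
    using assms flow_self[of P p S] flow_self[of P p "- S"] flow_commute[of P p S "- S"]
    by (auto simp: s_def t_def c_def)
  \<comment> \<open>The test function scaled by s*t, which avoids denominators. It has mean zero
    under \<open>p\<close>, and its quadratic form is exactly s*t - c.\<close>
  define f :: "real^'a" where "f = (\<chi> x. if x \<in> S then t else - s)"
  have "0 \<le> (\<Sum>x\<in>UNIV. f $ x * (P *v f) $ x * pmf p x)"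
    using assms(5) by (simp add: positive_semidefinite_def)
  also have "\<dots> = (\<Sum>x\<in>UNIV. \<Sum>y\<in>UNIV. f $ x * f $ y * (pmf p x * P $ x $ y))"
    by (simp add: matrix_vector_mult_def sum_distrib_left sum_distrib_right mult_ac)
  also have "\<dots> = t * t * flow p P S S - s * t * flow p P S (- S)
      - s * t * flow p P (- S) S + s * s * flow p P (- S) (- S)"
    unfolding sum_UNIV_split[of _ S] flow_def
    by (simp add: f_def sum.distrib sum_subtractf sum_negf sum_distrib_left mult_ac)
  also have "\<dots> = s * t * (s + t) - c * (s + t)\<^sup>2"
    unfolding fl c_def[symmetric] by (simp add: power2_eq_square algebra_simps)
  also have "\<dots> = s * t - c" using st by simp
  finally show ?thesis using st by (simp add: divide_simps s_def t_def c_def)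
qed

text \<open>Reversing the second step turns a two-step path from A to A through y into two flows
  from A into y, so each midpoint contributes a square. This matches the squares in the
  norm.\<close>

lemma flow_matrix_square:
  assumes "\<forall>x. 0 < pmf p x" "P \<in> reversible_kernels p"
  shows "flow p (P ** P) A A = (\<Sum>y\<in>UNIV. (flow p P A {y})\<^sup>2 / pmf p y)"
proof -
  have "pmf p x * (P ** P) $ x $ z
      = (\<Sum>y\<in>UNIV. (pmf p x * P $ x $ y) * (pmf p z * P $ z $ y) / pmf p y)" for x z
  proof -
    have "P $ y $ z = pmf p z * P $ z $ y / pmf p y" for y
    proof -
      have "pmf p y * P $ y $ z = pmf p z * P $ z $ y" and "pmf p y \<noteq> 0"
        using assms less_imp_neq[of 0 "pmf p y"] by (auto simp: reversible_kernels_def)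
      then show ?thesis by (simp add: nonzero_eq_divide_eq mult.commute)
    qed
    then show ?thesis by (simp add: matrix_matrix_mult_def sum_distrib_left mult.assoc)
  qed
  then have "flow p (P ** P) A A
      = (\<Sum>x\<in>A. \<Sum>z\<in>A. \<Sum>y\<in>UNIV. (pmf p x * P $ x $ y) * (pmf p z * P $ z $ y) / pmf p y)"
    by (simp add: flow_def)
  also have "\<dots> = (\<Sum>x\<in>A. \<Sum>y\<in>UNIV. \<Sum>z\<in>A. (pmf p x * P $ x $ y) * (pmf p z * P $ z $ y) / pmf p y)"
    by (intro sum.cong refl sum.swap)
  also have "\<dots> = (\<Sum>y\<in>UNIV. \<Sum>x\<in>A. \<Sum>z\<in>A. (pmf p x * P $ x $ y) * (pmf p z * P $ z $ y) / pmf p y)"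
    by (rule sum.swap)
  also have "\<dots> = (\<Sum>y\<in>UNIV. (flow p P A {y})\<^sup>2 / pmf p y)"
    by (simp add: flow_def power2_eq_square sum_product sum_divide_distrib)
  finally show ?thesis .
qed

lemma sum_flow_singleton:
  assumes "P \<in> reversible_kernels p"
  shows "(\<Sum>y\<in>UNIV. flow p P A {y}) = measure_pmf.prob p A"
proof -
  have "(\<Sum>y\<in>UNIV. flow p P A {y}) = (\<Sum>x\<in>A. pmf p x * (\<Sum>y\<in>UNIV. P $ x $ y))"
    unfolding flow_def sum_distrib_left by (simp add: sum.swap[of _ UNIV])
  then show ?thesis
    using assms by (simp add: reversible_kernels_def measure_measure_pmf_finite)
qed

lemma frobenius_norm_gibbs_mult_square:
  assumes "\<forall>x. 0 < pmf p x" "P \<in> reversible_kernels p" "S \<noteq> {}" "S \<noteq> UNIV"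
  shows "(frobenius_norm p (gibbs_kernel p S ** P - stationary_matrix p))\<^sup>2
    = flow p (P ** P) S S / measure_pmf.prob p S
      + flow p (P ** P) (- S) (- S) / measure_pmf.prob p (- S) - 1"
proof -
  have S': "- S \<noteq> {}" using assms(4) by auto
  \<comment> \<open>The chi-square distance to \<open>p\<close> of the law of the chain after one
    step from \<open>p\<close> conditioned on A.\<close>
  define k where
    "k A = (\<Sum>y\<in>UNIV. (flow p P A {y} / measure_pmf.prob p A - pmf p y)\<^sup>2 / pmf p y)" for A
  have k: "k A = flow p (P ** P) A A / (measure_pmf.prob p A)\<^sup>2 - 1" if "A \<noteq> {}" for A
  proof -
    have a: "measure_pmf.prob p A > 0" using prob_pos assms(1) that by blast
    have "(flow p P A {y} / measure_pmf.prob p A - pmf p y)\<^sup>2 / pmf p y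
      = (flow p P A {y})\<^sup>2 / pmf p y / (measure_pmf.prob p A)\<^sup>2
        - 2 * flow p P A {y} / measure_pmf.prob p A + pmf p y" for y
      using a assms(1)[rule_format, of y] by (simp add: power2_eq_square field_simps)
    \<comment> \<open>The cross term sums to -2 and the last sum to 1, leaving the -1 in
      \<open>k\<close>.\<close>
    then have "k A = (\<Sum>y\<in>UNIV. (flow p P A {y})\<^sup>2 / pmf p y) / (measure_pmf.prob p A)\<^sup>2
        - 2 * (\<Sum>y\<in>UNIV. flow p P A {y}) / measure_pmf.prob p A + (\<Sum>y\<in>UNIV. pmf p y)"
      unfolding k_def by (simp add: sum.distrib sum_subtractf sum_divide_distrib sum_distrib_left)
    then show ?thesis
      using a assms(1,2) by (simp add: flow_matrix_square sum_flow_singleton sum_pmf_eq_1)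
  qed
  have "(frobenius_norm p (gibbs_kernel p S ** P - stationary_matrix p))\<^sup>2
    = (\<Sum>x\<in>UNIV. pmf p x * k (block S x))"
    unfolding frobenius_norm_square[OF assms(1)] k_def sum_distrib_left
    by (simp add: gibbs_kernel_mult_nth stationary_matrix_def)
  also have "\<dots> = measure_pmf.prob p S * k S + measure_pmf.prob p (- S) * k (- S)"
    by (rule sum_block)
  also have "\<dots> = flow p (P ** P) S S / measure_pmf.prob p S
      + flow p (P ** P) (- S) (- S) / measure_pmf.prob p (- S)
      - (measure_pmf.prob p S + measure_pmf.prob p (- S))"
    using prob_pos[OF assms(1,3)] prob_pos[OF assms(1) S']
    by (simp add: k assms(3) S' power2_eq_square right_diff_distrib)
  finally show ?thesis by (simp add: prob_Compl_pmf)
qed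

theorem proposition6p10:
  fixes p :: "'a::finite pmf" and P :: "real^'a^'a"
  assumes pos: "\<forall>x. 0 < pmf p x"
    and rev: "P \<in> reversible_kernels p"
  shows "(positive_semidefinite p P \<longrightarrow>
       (\<forall>S. S \<noteq> {} \<longrightarrow> S \<noteq> UNIV \<longrightarrow>
         frobenius_norm p (gibbs_kernel p S ** P ** gibbs_kernel p S - stationary_matrix p) =
           (3 - 1 / (measure_pmf.prob p S * measure_pmf.prob p (- S)))
           + 1 / measure_pmf.prob p S * (\<Sum>x\<in>- S. \<Sum>y\<in>- S. pmf p x * P $ x $ y)
           + 1 / measure_pmf.prob p (- S) * (\<Sum>x\<in>S. \<Sum>y\<in>S. pmf p x * P $ x $ y))
       \<and> submodular p (\<lambda>S. 3 - 1 / (measure_pmf.prob p S * measure_pmf.prob p (- S)))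
       \<and> supermodular p (\<lambda>S. 1 / measure_pmf.prob p S * (\<Sum>x\<in>- S. \<Sum>y\<in>- S. pmf p x * P $ x $ y))
       \<and> supermodular p (\<lambda>S. 1 / measure_pmf.prob p (- S) * (\<Sum>x\<in>S. \<Sum>y\<in>S. pmf p x * P $ x $ y))
       \<and> submodular p (\<lambda>S. -
           (1 / measure_pmf.prob p S * (\<Sum>x\<in>- S. \<Sum>y\<in>- S. pmf p x * P $ x $ y)
           + 1 / measure_pmf.prob p (- S) * (\<Sum>x\<in>S. \<Sum>y\<in>S. pmf p x * P $ x $ y))))
     \<and>
       (\<forall>S. S \<noteq> {} \<longrightarrow> S \<noteq> UNIV \<longrightarrow>
         (frobenius_norm p (gibbs_kernel p S ** P - stationary_matrix p))\<^sup>2 =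
           (3 - 1 / (measure_pmf.prob p S * measure_pmf.prob p (- S)))
           + 1 / measure_pmf.prob p S * (\<Sum>x\<in>- S. \<Sum>y\<in>- S. pmf p x * (P ** P) $ x $ y)
           + 1 / measure_pmf.prob p (- S) * (\<Sum>x\<in>S. \<Sum>y\<in>S. pmf p x * (P ** P) $ x $ y))
       \<and> submodular p (\<lambda>S. 3 - 1 / (measure_pmf.prob p S * measure_pmf.prob p (- S)))
       \<and> supermodular p (\<lambda>S. 1 / measure_pmf.prob p S * (\<Sum>x\<in>- S. \<Sum>y\<in>- S. pmf p x * (P ** P) $ x $ y))
       \<and> supermodular p (\<lambda>S. 1 / measure_pmf.prob p (- S) * (\<Sum>x\<in>S. \<Sum>y\<in>S. pmf p x * (P ** P) $ x $ y))
       \<and> submodular p (\<lambda>S. -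
           (1 / measure_pmf.prob p S * (\<Sum>x\<in>- S. \<Sum>y\<in>- S. pmf p x * (P ** P) $ x $ y)
           + 1 / measure_pmf.prob p (- S) * (\<Sum>x\<in>S. \<Sum>y\<in>S. pmf p x * (P ** P) $ x $ y)))"
proof -
  have sq: "P ** P \<in> reversible_kernels p"
    by (rule reversible_kernels_square[OF rev])
  have "frobenius_norm p (gibbs_kernel p S ** P ** gibbs_kernel p S - stationary_matrix p) =
      (3 - 1 / (measure_pmf.prob p S * measure_pmf.prob p (- S)))
      + 1 / measure_pmf.prob p S * flow p P (- S) (- S)
      + 1 / measure_pmf.prob p (- S) * flow p P S S"
    if psd: "positive_semidefinite p P" and S: "S \<noteq> {}" "S \<noteq> UNIV" for S
    unfolding flow_decomposition(1)[OF pos rev S]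
  \<comment> \<open>Only the squares are known to agree; both sides are nonnegative, the right one
    by positive semidefiniteness.\<close>
  proof (rule power2_eq_imp_eq[OF frobenius_norm_sandwich_square[OF pos rev S]])
    show "0 \<le> frobenius_norm p (gibbs_kernel p S ** P ** gibbs_kernel p S - stationary_matrix p)"
      unfolding frobenius_norm_def trace_def pi_adjoint_def matrix_matrix_mult_def
      by (auto intro!: sum_nonneg simp: mult.assoc)
  qed (use positive_semidefinite_flow_le[OF pos rev S psd] in simp)
  moreover have "(frobenius_norm p (gibbs_kernel p S ** P - stationary_matrix p))\<^sup>2 =
      (3 - 1 / (measure_pmf.prob p S * measure_pmf.prob p (- S)))
      + 1 / measure_pmf.prob p S * flow p (P ** P) (- S) (- S)
      + 1 / measure_pmf.prob p (- S) * flow p (P ** P) S S"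
    if S: "S \<noteq> {}" "S \<noteq> UNIV" for S
    \<comment> \<open>Both sides become 1 - c/(s*t), with c the crossing flow of
      \<open>P ** P\<close>.\<close>
    unfolding frobenius_norm_gibbs_mult_square[OF pos rev S]
      flow_decomposition(1)[OF pos sq S] flow_decomposition(2)[OF pos sq S] ..
  moreover note submodular_first_term[of p]
    supermodular_second_term[OF rev] supermodular_third_term[OF rev]
    submodular_uminus_add[OF supermodular_second_term[OF rev] supermodular_third_term[OF rev]]
    supermodular_second_term[OF sq] supermodular_third_term[OF sq]
    submodular_uminus_add[OF supermodular_second_term[OF sq] supermodular_third_term[OF sq]]
  ultimately show ?thesis
    unfolding flow_def by (intro conjI impI allI)
qed

end
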